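(* Let $(G,+,\rhd,\lhd,\Phi)$ be a two-sided twisted post-group with sub-adjacent operation $\circ$ such that $(G,+)$ is abelian. Let $a\bullet b=(a\circ 0^{\dagger})\circ b$ for $a,b\in G$, where $0$ is the identity of $(G,+)$. Define $*:G\times G\to G$ by $$a*b=a\bullet b-a-b,\quad\forall a,b\in G.$$ Then $(G,+,* )$ is a radical ring.
   Context: A left twisted post-group $(G,+,\rhd,\Phi)$ (group written additively) is a group $(G,+)$ with maps $\rhd:G\times G\to G$, $\Phi:G\to G$ such that, setting $a\circ b=\Phi(a)+(a\rhd b)$ (sub-adjacent operation), for all $a,b,c\in G$: $L_a^{\rhd}:b\mapsto a\rhd b$ is an automorphism of $(G,+)$; $(a\circ b)\rhd c=a\rhd(b\rhd c)$; $\Phi(a\circ b)=a\circ\Phi(b)$. A right twisted post-group $(G,+,\lhd,\Phi)$ is a group $(G,+)$ with maps $\lhd$, $\Phi$ such that, setting $a\circ b=(a\lhd b)+\Phi(b)$ (sub-adjacent operation), for all $a,b,c\in G$: $a\mapsto a\lhd b$ is an automorphism of $(G,+)$; $a\lhd(b\circ c)=(a\lhd b)\lhd c$; $\Phi(a\circ b)=\Phi(a)\circ b$. A two-sided twisted post-group is a quintuple $(G,+,\rhd,\lhd,\Phi)$ such that $(G,+,\rhd,\Phi)$ is a left twisted post-group, $(G,+,\lhd,\Phi)$ is a right twisted post-group, and both have the same sub-adjacent operation $\circ$. For $a\in G$ put $e_a=(L_a^{\rhd})^{-1}(-\Phi(a)+a)$ and $a^{\dagger}=(L_a^{\rhd})^{-1}(-\Phi(a)+e_a)$;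 $0^{\dagger}$ is the case $a=0$. A radical ring is a nonunital (i.e. not necessarily unital, associative) ring $(R,+,\cdot)$ such that for any $a\in R$ there is $b\in R$ with $a+b+a\cdot b=0$. *)

theory Defs
  imports Main
begin

text \<open>Groups are written additively and carried by a type of class \<^class>\<open>group_add\<close>,
  which does not assume commutativity.\<close>

definition add_automorphism :: "('a::group_add \<Rightarrow> 'a) \<Rightarrow> bool" where
  "add_automorphism f \<longleftrightarrow> bij f \<and> (\<forall>x y. f (x + y) = f x + f y)"

definition left_subadj :: "('a::group_add \<Rightarrow> 'a \<Rightarrow> 'a) \<Rightarrow> ('a \<Rightarrow> 'a) \<Rightarrow> 'a \<Rightarrow> 'a \<Rightarrow> 'a" where
  "left_subadj lact \<Phi> a b = \<Phi> a + lact a b"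

definition right_subadj :: "('a::group_add \<Rightarrow> 'a \<Rightarrow> 'a) \<Rightarrow> ('a \<Rightarrow> 'a) \<Rightarrow> 'a \<Rightarrow> 'a \<Rightarrow> 'a" where
  "right_subadj ract \<Phi> a b = ract a b + \<Phi> b"

locale left_twisted_post_group =
  fixes lact :: "'a::group_add \<Rightarrow> 'a \<Rightarrow> 'a"  (infixl "\<rhd>" 70)
    and \<Phi> :: "'a \<Rightarrow> 'a"
  assumes lact_automorphism: "add_automorphism (\<lambda>b. a \<rhd> b)"
    and lact_lact: "left_subadj (\<rhd>) \<Phi> a b \<rhd> c = a \<rhd> (b \<rhd> c)"
    and Phi_left_subadj: "\<Phi> (left_subadj (\<rhd>) \<Phi> a b) = left_subadj (\<rhd>) \<Phi> a (\<Phi> b)"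

locale right_twisted_post_group =
  fixes ract :: "'a::group_add \<Rightarrow> 'a \<Rightarrow> 'a"  (infixl "\<lhd>" 70)
    and \<Phi> :: "'a \<Rightarrow> 'a"
  assumes ract_automorphism: "add_automorphism (\<lambda>a. a \<lhd> b)"
    and ract_ract: "a \<lhd> right_subadj (\<lhd>) \<Phi> b c = (a \<lhd> b) \<lhd> c"
    and Phi_right_subadj: "\<Phi> (right_subadj (\<lhd>) \<Phi> a b) = right_subadj (\<lhd>) \<Phi> (\<Phi> a) b"

locale two_sided_twisted_post_group =
  left_twisted_post_group lact \<Phi> + right_twisted_post_group ract \<Phi>
  for lact :: "'a::group_add \<Rightarrow> 'a \<Rightarrow> 'a"  (infixl "\<rhd>" 70)
    and ract :: "'a \<Rightarrow> 'a \<Rightarrow> 'a"  (infixl "\<lhd>" 70)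
    and \<Phi> :: "'a \<Rightarrow> 'a" +
  assumes same_subadj: "left_subadj (\<rhd>) \<Phi> = right_subadj (\<lhd>) \<Phi>"

text \<open>With \<open>\<circ>\<close> the sub-adjacent operation, \<open>local_unit lact \<Phi> a\<close> is the element \<open>e\<close> with
  \<open>a \<circ> e = a\<close>, and \<open>dagger lact \<Phi> a\<close> is the element \<open>d\<close> with \<open>a \<circ> d = e\<close>.\<close>

definition local_unit :: "('a::group_add \<Rightarrow> 'a \<Rightarrow> 'a) \<Rightarrow> ('a \<Rightarrow> 'a) \<Rightarrow> 'a \<Rightarrow> 'a" where
  "local_unit lact \<Phi> a = inv (lact a) (- \<Phi> a + a)"

definition dagger :: "('a::group_add \<Rightarrow> 'a \<Rightarrow> 'a) \<Rightarrow> ('a \<Rightarrow> 'a) \<Rightarrow> 'a \<Rightarrow> 'a" where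
  "dagger lact \<Phi> a = inv (lact a) (- \<Phi> a + local_unit lact \<Phi> a)"

definition bullet :: "('a::group_add \<Rightarrow> 'a \<Rightarrow> 'a) \<Rightarrow> ('a \<Rightarrow> 'a) \<Rightarrow> 'a \<Rightarrow> 'a \<Rightarrow> 'a" where
  "bullet lact \<Phi> a b =
     left_subadj lact \<Phi> (left_subadj lact \<Phi> a (dagger lact \<Phi> 0)) b"

text \<open>The class predicate of \<^class>\<open>ring\<close> describes associative rings not assumed to be unital;
  it also contains commutativity of addition. Only the multiplication is a
  parameter here; the additive structure is that of the ambient type.\<close>

definition radical_ring :: "('a::group_add \<Rightarrow> 'a \<Rightarrow> 'a) \<Rightarrow> bool" where
  "radical_ring m \<longleftrightarrow>
     class.ring (+) 0 (-) uminus m \<and> (\<forall>a. \<exists>b. a + b + m a b = 0)"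

end

theory Submission
  imports Defs
begin

text \<open>
  The sub-adjacent operation \<open>\<circ>\<close> is associative, its left translations \<open>b \<mapsto> \<Phi> a + a \<rhd> b\<close> are
  bijective by the left structure, and its right translations \<open>a \<mapsto> a \<lhd> b + \<Phi> b\<close> by the right
  structure. An associative operation with bijective translations
  is a group operation, so every local unit is the identity \<open>e\<close> of \<open>\<circ>\<close>, and the dagger \<open>d\<close> of
  \<open>0\<close> is the inverse of \<open>0\<close> for \<open>\<circ>\<close>.
  Hence \<open>a \<bullet> b = a \<circ> d \<circ> b\<close> is the isotopic group operation, whose identity is \<open>0\<close>.

  Distributivity comes from the fact that \<open>\<Phi>\<close> is a translation by \<open>0\<close>, on either side:
  \<open>x \<circ> 0 = \<Phi> x = 0 \<circ> x\<close>. Thus \<open>\<Phi> (a \<circ> d) = a \<circ> d \<circ> 0 = a\<close>, so that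
  \<open>a \<bullet> b = a + (a \<circ> d) \<rhd> b\<close>, and when addition commutes \<open>a * b = (a \<circ> d) \<rhd> b - b\<close> is additive in
  \<open>b\<close>; symmetrically \<open>a \<bullet> b = a \<lhd> (d \<circ> b) + b\<close> makes \<open>a * b\<close> additive in \<open>a\<close>.
  Given biadditivity, associativity of \<open>*\<close> is equivalent to that of \<open>\<bullet>\<close>, and the inverses of
  \<open>\<bullet>\<close> are the quasi-inverses required of a radical ring.
\<close>

text \<open>By biadditivity both bracketings of the circle operation \<open>a + b + m a b\<close> expand to the same
  six terms of degrees one and two plus a single cubic term, \<open>m (m a b) c\<close> or \<open>m a (m b c)\<close>,
  so associativity of the circle operation forces that of \<open>m\<close>.\<close>

lemma radical_ring_if_circle_assoc:
  fixes m :: "'a::group_add \<Rightarrow> 'a \<Rightarrow> 'a"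
  assumes comm: "\<And>a b :: 'a. a + b = b + a"
    and distr: "\<And>a b c. m (a + b) c = m a c + m b c"
    and distl: "\<And>a b c. m a (b + c) = m a b + m a c"
    and circle_assoc: "\<And>a b c. (a + b + m a b) + c + m (a + b + m a b) c
      = a + (b + c + m b c) + m a (b + c + m b c)"
    and quasi_inverse: "\<And>a. \<exists>b. a + b + m a b = 0"
  shows "radical_ring m"
proof -
  have lcomm: "a + (b + c) = b + (a + c)" for a b c :: 'a
    by (metis add.assoc comm)
  have m_assoc: "m (m a b) c = m a (m b c)" for a b c
  proof -
    define q where "q = a + (b + (c + (m a b + (m a c + m b c))))"
    have "(a + b + m a b) + c + m (a + b + m a b) c = q + m (m a b) c"
      unfolding q_def distr by (simp add: add.assoc comm lcomm)
    moreover have "a + (b + c + m b c) + m a (b + c + m b c) = q + m a (m b c)"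
      unfolding q_def distl by (simp add: add.assoc comm lcomm)
    ultimately show ?thesis
      using circle_assoc by simp
  qed
  have "class.ring (+) 0 (-) uminus m"
    by unfold_locales (simp_all add: comm distr distl m_assoc)
  then show ?thesis
    unfolding radical_ring_def using quasi_inverse by blast
qed

lemma add_automorphism_zero:
  assumes "add_automorphism f"
  shows "f 0 = 0"
  using assms unfolding add_automorphism_def by (metis add.right_neutral add_left_cancel)

context left_twisted_post_group
begin

abbreviation subadj (infixl "\<circ>\<^sub>\<rhd>" 70) where
  "a \<circ>\<^sub>\<rhd> b \<equiv> left_subadj lact \<Phi> a b"

lemma lact_add: "a \<rhd> (b + c) = a \<rhd> b + a \<rhd> c"
  using lact_automorphism unfolding add_automorphism_def by blast

lemma lact_inv: "a \<rhd> inv (lact a) b = b"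
  using lact_automorphism unfolding add_automorphism_def by (metis bij_inv_eq_iff)

lemma subadj_assoc: "(a \<circ>\<^sub>\<rhd> b) \<circ>\<^sub>\<rhd> c = a \<circ>\<^sub>\<rhd> (b \<circ>\<^sub>\<rhd> c)"
proof -
  have "(a \<circ>\<^sub>\<rhd> b) \<circ>\<^sub>\<rhd> c = a \<circ>\<^sub>\<rhd> \<Phi> b + a \<rhd> (b \<rhd> c)"
    by (metis Phi_left_subadj lact_lact left_subadj_def)
  then show ?thesis
    by (simp add: left_subadj_def lact_add add.assoc)
qed

lemma subadj_left_cancel: "a \<circ>\<^sub>\<rhd> b = a \<circ>\<^sub>\<rhd> c \<longleftrightarrow> b = c"
  using lact_automorphism unfolding add_automorphism_def left_subadj_def
  by (metis add_left_cancel bij_pointE)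

lemma subadj_solve_right: "\<exists>b. a \<circ>\<^sub>\<rhd> b = c"
proof
  show "a \<circ>\<^sub>\<rhd> inv (lact a) (- \<Phi> a + c) = c"
    by (simp add: left_subadj_def lact_inv flip: add.assoc)
qed

lemma subadj_zero_right: "a \<circ>\<^sub>\<rhd> 0 = \<Phi> a"
  by (simp add: left_subadj_def add_automorphism_zero[OF lact_automorphism])

lemma subadj_local_unit: "a \<circ>\<^sub>\<rhd> local_unit lact \<Phi> a = a"
  by (simp add: left_subadj_def local_unit_def lact_inv flip: add.assoc)

lemma subadj_dagger: "a \<circ>\<^sub>\<rhd> dagger lact \<Phi> a = local_unit lact \<Phi> a"
  by (simp add: left_subadj_def dagger_def lact_inv flip: add.assoc)

end

context two_sided_twisted_post_group
begin

lemma subadj_eq_ract: "a \<circ>\<^sub>\<rhd> b = a \<lhd> b + \<Phi> b"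
  by (simp add: same_subadj right_subadj_def)

lemma ract_add: "(a + b) \<lhd> c = a \<lhd> c + b \<lhd> c"
  using ract_automorphism unfolding add_automorphism_def by blast

lemma subadj_right_cancel: "a \<circ>\<^sub>\<rhd> c = b \<circ>\<^sub>\<rhd> c \<longleftrightarrow> a = b"
  using ract_automorphism[of c] unfolding add_automorphism_def subadj_eq_ract
  by (metis add_right_cancel bij_pointE)

lemma subadj_zero_left: "0 \<circ>\<^sub>\<rhd> a = \<Phi> a"
  by (simp add: subadj_eq_ract add_automorphism_zero[OF ract_automorphism])

text \<open>Cancellation on both sides turns one local unit into a global one: left cancellation of
  \<open>a\<close> in \<open>a \<circ> e \<circ> b = a \<circ> b\<close> makes \<open>e\<close> a left unit, and right cancellation
  of \<open>c\<close> in \<open>b \<circ> e \<circ> c = b \<circ> c\<close> then makes it a right unit.\<close>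

lemma local_unit_left: "local_unit lact \<Phi> a \<circ>\<^sub>\<rhd> b = b"
  by (metis subadj_assoc subadj_left_cancel subadj_local_unit)

lemma local_unit_right: "b \<circ>\<^sub>\<rhd> local_unit lact \<Phi> a = b"
  by (metis subadj_assoc subadj_right_cancel local_unit_left)

lemma dagger_subadj: "dagger lact \<Phi> a \<circ>\<^sub>\<rhd> a = local_unit lact \<Phi> a"
proof -
  have "a \<circ>\<^sub>\<rhd> (dagger lact \<Phi> a \<circ>\<^sub>\<rhd> a) = a \<circ>\<^sub>\<rhd> local_unit lact \<Phi> a"
    by (simp add: subadj_dagger local_unit_left local_unit_right flip: subadj_assoc)
  then show ?thesis
    by (simp add: subadj_left_cancel)
qed

lemma bullet_assoc:
  "bullet lact \<Phi> (bullet lact \<Phi> a b) c = bullet lact \<Phi> a (bullet lact \<Phi> b c)"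
  by (simp add: bullet_def subadj_assoc)

lemma bullet_right_inverse: "\<exists>b. bullet lact \<Phi> a b = 0"
  unfolding bullet_def by (rule subadj_solve_right)

text \<open>The constant term of the affine map \<open>b \<mapsto> a \<bullet> b\<close> is \<open>\<Phi> (a \<circ> d) = a \<circ> d \<circ> 0 = a\<close>,
  where \<open>d\<close> is the inverse of \<open>0\<close>.\<close>

lemma bullet_eq_lact: "bullet lact \<Phi> a b = a + (a \<circ>\<^sub>\<rhd> dagger lact \<Phi> 0) \<rhd> b"
proof -
  have "\<Phi> (a \<circ>\<^sub>\<rhd> dagger lact \<Phi> 0) = a"
    by (metis subadj_zero_right subadj_assoc dagger_subadj local_unit_right)
  then show ?thesis
    by (simp add: bullet_def left_subadj_def[of lact \<Phi> "a \<circ>\<^sub>\<rhd> dagger lact \<Phi> 0"])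
qed

lemma bullet_eq_ract: "bullet lact \<Phi> a b = a \<lhd> (dagger lact \<Phi> 0 \<circ>\<^sub>\<rhd> b) + b"
proof -
  have "\<Phi> (dagger lact \<Phi> 0 \<circ>\<^sub>\<rhd> b) = b"
    by (metis subadj_zero_left subadj_assoc subadj_dagger local_unit_left)
  then show ?thesis
    unfolding bullet_def subadj_assoc by (simp add: subadj_eq_ract[of a])
qed

end

theorem corollary4p17:
  fixes lact ract :: "'a::group_add \<Rightarrow> 'a \<Rightarrow> 'a"
    and \<Phi> :: "'a \<Rightarrow> 'a"
  assumes "two_sided_twisted_post_group lact ract \<Phi>"
    and "\<forall>a b :: 'a. a + b = b + a"
  shows "radical_ring (\<lambda>a b. bullet lact \<Phi> a b - a - b)"
proof -
  interpret two_sided_twisted_post_group lact ract \<Phi>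
    by (fact assms(1))
  have comm: "a + b = b + a" for a b :: 'a
    using assms(2) by blast
  have lcomm: "a + (b + c) = b + (a + c)" for a b c :: 'a
    by (metis add.assoc comm)
  note ac = add.assoc comm lcomm
  let ?m = "\<lambda>a b. bullet lact \<Phi> a b - a - b"
  have left: "?m a b = lact (a \<circ>\<^sub>\<rhd> dagger lact \<Phi> 0) b - b" for a b
    unfolding bullet_eq_lact by (simp add: comm[of a])
  have right: "?m a b = ract a (dagger lact \<Phi> 0 \<circ>\<^sub>\<rhd> b) - a" for a b
  proof -
    have "x + b - a = x - a + b" for x
      by (simp only: diff_conv_add_uminus ac)
    then show ?thesis
      by (simp add: bullet_eq_ract)
  qed
  have circle: "a + b + ?m a b = bullet lact \<Phi> a b" for a b
    by (simp add: diff_conv_add_uminus ac del: add_uminus_conv_diff)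
  show ?thesis
  proof (rule radical_ring_if_circle_assoc)
    show "?m (a + b) c = ?m a c + ?m b c" for a b c
      unfolding right ract_add by (simp only: diff_conv_add_uminus minus_add ac)
    show "?m a (b + c) = ?m a b + ?m a c" for a b c
      unfolding left lact_add by (simp only: diff_conv_add_uminus minus_add ac)
    show "(a + b + ?m a b) + c + ?m (a + b + ?m a b) c
        = a + (b + c + ?m b c) + ?m a (b + c + ?m b c)" for a b c
      unfolding circle by (rule bullet_assoc)
    show "\<exists>b. a + b + ?m a b = 0" for a
      unfolding circle by (rule bullet_right_inverse)
  qed (rule comm)
qed

end
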